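(* Let $a\in L^1(I)$ and $\lambda\in\mathbb{R}$. If the operator $L[\lambda]$ is nonresonant in $X_N$ and in $X_{M_2}$, then for all $(t,s)\in I\times I$ $$G_{M_2}[\lambda](t,s)=G_N[\lambda](t,s)+r_5[\lambda](t)\,\frac{\partial}{\partial t}G_{M_2}[\lambda](0,s)$$ $$=G_N[\lambda](t,s)+G_N[\lambda](t,0)\,\frac{\partial}{\partial t}G_{M_2}[\lambda](0,s).$$
   Context: $I=[0,1]$, $a\in L^1(I)$ is real-valued, $\lambda\in\mathbb{R}$, and $L[\lambda]u(t)=u''(t)+(a(t)+\lambda)u(t)$. $W^{2,1}(I)=\{u\in C(I):u'\in AC(I)\}$, where $AC(I)$ is the set of absolutely continuous functions on $I$. $X_N=\{u\in W^{2,1}(I):u'(0)=u'(1)=0\}$ (Neumann) and $X_{M_2}=\{u\in W^{2,1}(I):u(0)=u'(1)=0\}$ (Mixed 2). $L[\lambda]$ is nonresonant in $X$ if $u=0$ is the only $u\in X$ with $L[\lambda]u=0$ a.e. on $I$. In that case, for every $\sigma\in L^1(I)$ the problem $L[\lambda]u=\sigma$ a.e. on $I$, $u\in X$, has a unique solution, given by $u(t)=\int_0^1G(t,s)\sigma(s)\,ds$, where the continuous function $G:I\times I\to\mathbb{R}$ is the Green's function; it is denoted $G_N[\lambda]$ for $X=X_N$ and $G_{M_2}[\lambda]$ for $X=X_{M_2}$. $r_5[\lambda]$ is the unique solution of $L[\lambda]u=0$ a.e. on $I$, $u'(0)=1$, $u'(1)=0$. Convention: $\frac{\partial}{\partial t}G(0,s)$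 (derivative with respect to the first variable at $t=0$) is the one-sided derivative for $s\in(0,1)$, extended by continuity to $s\in\{0,1\}$. *)

theory Defs
  imports "HOL-Analysis.Analysis"
begin

text \<open>Functions on \<open>I\<close> are total functions on the reals. Every notion below depends only on their
  values on \<open>I\<close>.\<close>

abbreviation I :: "real set" where "I \<equiv> {0..1}"

text \<open>Derivative relative to \<open>I\<close>, hence one-sided at the endpoints.\<close>

definition dI :: "(real \<Rightarrow> real) \<Rightarrow> real \<Rightarrow> real" where
  "dI u t = vector_derivative u (at t within I)"

definition AC :: "(real \<Rightarrow> real) set" where
  "AC = {f. \<forall>\<epsilon>>0. \<exists>\<delta>>0. \<forall>(n::nat) (x::nat \<Rightarrow> real) (y::nat \<Rightarrow> real).
     (\<forall>i<n. x i \<in> I \<and> y i \<in> I \<and> x i \<le> y i) \<and>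
     (\<forall>i<n. \<forall>j<n. i \<noteq> j \<longrightarrow> {x i<..<y i} \<inter> {x j<..<y j} = {}) \<and>
     (\<Sum>i<n. y i - x i) < \<delta>
     \<longrightarrow> (\<Sum>i<n. \<bar>f (y i) - f (x i)\<bar>) < \<epsilon>}"

definition W21 :: "(real \<Rightarrow> real) set" where
  "W21 = {u. (\<forall>t\<in>I. u differentiable (at t within I)) \<and> dI u \<in> AC}"

definition X_N :: "(real \<Rightarrow> real) set" where
  "X_N = {u \<in> W21. dI u 0 = 0 \<and> dI u 1 = 0}"

definition X_M2 :: "(real \<Rightarrow> real) set" where
  "X_M2 = {u \<in> W21. u 0 = 0 \<and> dI u 1 = 0}"

definition L :: "(real \<Rightarrow> real) \<Rightarrow> real \<Rightarrow> (real \<Rightarrow> real) \<Rightarrow> real \<Rightarrow> real" where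
  "L a lam u t = dI (dI u) t + (a t + lam) * u t"

text \<open>\<open>L[lam] u = \<sigma>\<close> almost everywhere on \<open>I\<close>. Since \<^const>\<open>vector_derivative\<close> is total, the
  existence of \<open>u''(t)\<close> is spelled out; for \<open>u \<in> W21\<close> it holds almost everywhere anyway.\<close>

definition solves :: "(real \<Rightarrow> real) \<Rightarrow> real \<Rightarrow> (real \<Rightarrow> real) \<Rightarrow> (real \<Rightarrow> real) \<Rightarrow> bool" where
  "solves a lam u \<sigma> \<longleftrightarrow>
     (AE t in lebesgue. t \<in> I \<longrightarrow> dI u differentiable (at t within I) \<and> L a lam u t = \<sigma> t)"

definition nonresonant :: "(real \<Rightarrow> real) \<Rightarrow> real \<Rightarrow> (real \<Rightarrow> real) set \<Rightarrow> bool" where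
  "nonresonant a lam X \<longleftrightarrow>
     (\<forall>u\<in>X. solves a lam u (\<lambda>_. 0) \<longrightarrow> (\<forall>t\<in>I. u t = 0))"

definition is_green ::
  "(real \<Rightarrow> real) \<Rightarrow> real \<Rightarrow> (real \<Rightarrow> real) set \<Rightarrow> (real \<Rightarrow> real \<Rightarrow> real) \<Rightarrow> bool" where
  "is_green a lam X G \<longleftrightarrow>
     continuous_on (I \<times> I) (\<lambda>(t, s). G t s) \<and>
     (\<forall>\<sigma>. \<sigma> absolutely_integrable_on I \<longrightarrow>
        (let u = (\<lambda>t. LINT s:I|lebesgue. G t s * \<sigma> s)
         in u \<in> X \<and> solves a lam u \<sigma> \<and>
            (\<forall>v\<in>X. solves a lam v \<sigma> \<longrightarrow> (\<forall>t\<in>I. v t = u t))))"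

text \<open>In the nonresonant case the values of the Green's function on \<open>I \<times> I\<close>, and those of \<open>r5\<close>
  on \<open>I\<close>, are uniquely determined. The choice operator is used because values elsewhere are
  arbitrary.\<close>

definition green ::
  "(real \<Rightarrow> real) \<Rightarrow> real \<Rightarrow> (real \<Rightarrow> real) set \<Rightarrow> real \<Rightarrow> real \<Rightarrow> real" where
  "green a lam X = (SOME G. is_green a lam X G)"

definition G_N :: "(real \<Rightarrow> real) \<Rightarrow> real \<Rightarrow> real \<Rightarrow> real \<Rightarrow> real" where
  "G_N a lam = green a lam X_N"

definition G_M2 :: "(real \<Rightarrow> real) \<Rightarrow> real \<Rightarrow> real \<Rightarrow> real \<Rightarrow> real" where
  "G_M2 a lam = green a lam X_M2"

definition r5 :: "(real \<Rightarrow> real) \<Rightarrow> real \<Rightarrow> real \<Rightarrow> real" where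
  "r5 a lam = (SOME u. u \<in> W21 \<and> solves a lam u (\<lambda>_. 0) \<and> dI u 0 = 1 \<and> dI u 1 = 0)"

text \<open>The partial derivative of \<open>G\<close> in the first variable at \<open>(0, s)\<close>: the one-sided derivative for
  \<open>s\<close> in the open interval, extended by continuity to \<open>s = 0\<close> and \<open>s = 1\<close>.\<close>

definition dG0 :: "(real \<Rightarrow> real \<Rightarrow> real) \<Rightarrow> real \<Rightarrow> real" where
  "dG0 G s =
     (if s \<in> {0<..<1} then dI (\<lambda>t. G t s) 0
      else Lim (at s within {0<..<1}) (\<lambda>s'. dI (\<lambda>t. G t s') 0))"

end

theory Submission
  imports Defs
begin

text \<open>
Let \<open>\<phi>\<close> and \<open>\<psi>\<close> be the homogeneous solutions with \<open>\<phi>(0) = 1, \<phi>'(0) = 0\<close> and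
\<open>\<psi>(0) = 0, \<psi>'(0) = 1\<close>. Nonresonance in \<open>X_N\<close> and in \<open>X_M2\<close> means \<open>\<phi>'(1) \<noteq> 0\<close> and
\<open>\<psi>'(1) \<noteq> 0\<close>. With \<open>c = - \<psi>'(1) / \<phi>'(1) \<noteq> 0\<close>, the solution \<open>r = c \<phi> + \<psi>\<close> satisfies
\<open>r'(0) = 1\<close> and \<open>r'(1) = 0\<close>, so it is \<open>r5\<close>, and it serves both problems as the solution that is
admissible at the right end. At the left end \<open>\<phi>\<close> is admissible for the Neumann problem and \<open>\<psi>\<close>
for the mixed one. The Wronskians with \<open>r\<close> are \<open>1\<close> and \<open>- c\<close>, so variation of constants gives,
for \<open>t \<le> s\<close>, \<open>G_N(t, s) = \<phi>(t) r(s)\<close> and \<open>G_M2(t, s) = - \<psi>(t) r(s) / c\<close>, and for \<open>s \<le> t\<close> the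
same expressions with \<open>s\<close> and \<open>t\<close> exchanged. Consequently the derivative of \<open>G_M2\<close> in the first
variable at \<open>t = 0\<close> is \<open>- r(s) / c\<close>, and substituting \<open>\<psi> = r - c \<phi>\<close> turns the formula for
\<open>G_M2\<close> into \<open>G_N(t, s) - r(t) r(s) / c\<close>, which is the first identity. The second one holds as
\<open>G_N(t, 0) = \<phi>(0) r(t) = r(t)\<close>.

The analysis needed is that of linear equations with an integrable coefficient. It rests on
indefinite integrals of \<open>L\<^sup>1\<close> functions, encoded by \<open>primitive\<close>: the product rule
\<open>primitive_mult\<close> yields both the constancy of the Wronskian and variation of constants
(\<open>green_kernel_solves\<close>), while \<open>primitive_AC\<close> and \<open>primitive_has_derivative_AE\<close> translate the
integral identities into membership in \<open>W21\<close> and equations almost everywhere. Homogeneous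
solutions exist by a contraction argument in a weighted norm (\<open>hom_solution_exists\<close>), and
\<open>is_green_unique\<close> identifies the chosen Green's functions with the explicit kernels.
\<close>

section \<open>Indefinite integrals and their product rule\<close>

text \<open>Absolutely continuous functions enter as indefinite integrals with a named integrable density.
The density is the almost everywhere derivative, but as long as only the integral
representation is used, sums, products and equations can be handled pointwise on \<open>I\<close>, without
exceptional null sets.\<close>

definition primitive :: "(real \<Rightarrow> real) \<Rightarrow> (real \<Rightarrow> real) \<Rightarrow> bool" where
  "primitive f F \<longleftrightarrow>
     f absolutely_integrable_on I \<and> (\<forall>t\<in>I. F t = F 0 + integral {0..t} f)"

lemma absolutely_integrable_mult_continuous:
  fixes f g :: "real \<Rightarrow> real"
  assumes f: "f absolutely_integrable_on I" and g: "continuous_on I g"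
  shows "(\<lambda>t. f t * g t) absolutely_integrable_on I"
proof -
  have "(\<lambda>t. g t * f t) absolutely_integrable_on I"
  proof (rule absolutely_integrable_bounded_measurable_product_real[OF _ _ _ f])
    show "g \<in> borel_measurable (lebesgue_on I)"
      by (rule continuous_imp_measurable_on_sets_lebesgue[OF g]) simp
    show "bounded (g ` I)"
      using compact_continuous_image[OF g] compact_imp_bounded by blast
  qed simp
  then show ?thesis by (simp add: mult.commute)
qed

lemma absolutely_integrable_on_subinterval_I:
  fixes f :: "real \<Rightarrow> real"
  assumes "f absolutely_integrable_on I" "0 \<le> x" "y \<le> 1"
  shows "f absolutely_integrable_on {x..y}"
  by (rule absolutely_integrable_on_subinterval[OF assms(1)]) (use assms in auto)

lemmas integrable_on_subinterval_I =
  absolutely_integrable_on_subinterval_I[THEN set_lebesgue_integral_eq_integral(1)]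

lemma primitive_absolutely_integrable:
  assumes "primitive f F" "0 \<le> x" "y \<le> 1"
  shows "f absolutely_integrable_on {x..y}"
  by (rule absolutely_integrable_on_subinterval_I[OF _ assms(2,3)])
     (use assms(1) in \<open>unfold primitive_def, blast\<close>)

lemma primitive_eq: "primitive f F \<Longrightarrow> t \<in> I \<Longrightarrow> F t = F 0 + integral {0..t} f"
  unfolding primitive_def by blast

lemmas primitive_integrable =
  primitive_absolutely_integrable[THEN set_lebesgue_integral_eq_integral(1)]

lemma primitive_increment:
  assumes "primitive f F" "0 \<le> x" "x \<le> y" "y \<le> 1"
  shows "F y - F x = integral {x..y} f"
proof -
  have "integral {0..x} f + integral {x..y} f = integral {0..y} f"
    by (rule Henstock_Kurzweil_Integration.integral_combine)
       (use assms in \<open>auto intro: primitive_integrable\<close>)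
  moreover have "F x = F 0 + integral {0..x} f" "F y = F 0 + integral {0..y} f"
    using primitive_eq[OF assms(1), of x] primitive_eq[OF assms(1), of y] assms(2-4) by simp_all
  ultimately show ?thesis by simp
qed

lemma primitive_increment_bound:
  assumes F: "primitive f F" and xy: "0 \<le> x" "x \<le> y" "y \<le> 1"
  shows "\<bar>F y - F x\<bar> \<le> integral {x..y} (\<lambda>s. \<bar>f s\<bar>)"
proof -
  have "f absolutely_integrable_on {x..y}"
    using primitive_absolutely_integrable[OF F] xy by simp
  then show ?thesis
    unfolding primitive_increment[OF assms]
    using integral_norm_bound_integral[of f "{x..y}" "\<lambda>s. \<bar>f s\<bar>"]
    by (simp add: absolutely_integrable_on_def)
qed

lemma primitive_continuous:
  assumes F: "primitive f F"
  shows "continuous_on I F"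
proof -
  have "continuous_on I (\<lambda>t. F 0 + integral {0..t} f)"
    using primitive_integrable[OF F, of 0 1]
    by (intro continuous_intros indefinite_integral_continuous_1) auto
  then show ?thesis
    by (rule continuous_on_eq) (simp add: primitive_eq[OF F, symmetric])
qed

lemma primitive_integral:
  assumes "f absolutely_integrable_on I"
  shows "primitive f (\<lambda>t. c + integral {0..t} f)"
  using assms by (simp add: primitive_def)

lemma primitive_cong:
  assumes "primitive f F" "\<And>t. t \<in> I \<Longrightarrow> f t = g t" "\<And>t. t \<in> I \<Longrightarrow> F t = G t"
  shows "primitive g G"
proof -
  have "g absolutely_integrable_on I"
    by (rule absolutely_integrable_spike[where f=f and S="{}"]) (use primitive_absolutely_integrable[OF assms(1), of 0 1] assms(2) in auto)
  moreover have "G t = G 0 + integral {0..t} g" if t: "t \<in> I" for t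
  proof -
    have "integral {0..t} f = integral {0..t} g"
      by (rule Henstock_Kurzweil_Integration.integral_cong) (use t assms in auto)
    then show ?thesis
      using primitive_eq[OF assms(1) t] assms(3)[OF t] assms(3)[of 0] by simp
  qed
  ultimately show ?thesis
    unfolding primitive_def by blast
qed

lemma primitive_add:
  assumes "primitive f F" "primitive g G"
  shows "primitive (\<lambda>t. f t + g t) (\<lambda>t. F t + G t)"
  unfolding primitive_def
proof (intro conjI ballI)
  show "(\<lambda>t. f t + g t) absolutely_integrable_on I"
    using assms unfolding primitive_def by (blast intro: set_integral_add)
  fix t assume t: "t \<in> I"
  have "integral {0..t} (\<lambda>t. f t + g t) = integral {0..t} f + integral {0..t} g"
    by (rule Henstock_Kurzweil_Integration.integral_add)
       (use assms t in \<open>auto intro: primitive_integrable\<close>)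
  then show "F t + G t = F 0 + G 0 + integral {0..t} (\<lambda>t. f t + g t)"
    using primitive_eq[OF assms(1) t] primitive_eq[OF assms(2) t] by simp
qed

lemma primitive_cmult:
  assumes "primitive f F"
  shows "primitive (\<lambda>t. c * f t) (\<lambda>t. c * F t)"
  unfolding primitive_def
proof (intro conjI ballI)
  show "(\<lambda>t. c * f t) absolutely_integrable_on I"
    using primitive_absolutely_integrable[OF assms, of 0 1] by simp
  show "c * F t = c * F 0 + integral {0..t} (\<lambda>t. c * f t)" if "t \<in> I" for t
    unfolding primitive_eq[OF assms that] by (simp add: algebra_simps)
qed

text \<open>The increments of \<open>H\<close> are dominated, on short intervals, by \<open>e\<close> times the increments of a fixed
function \<open>V\<close>. Summed over a fine uniform partition of \<open>{0..t}\<close> the latter telescope to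
\<open>e * (V t - V 0)\<close>, and \<open>e\<close> is arbitrary. This replaces the theorem that an absolutely
continuous function with derivative zero almost everywhere is constant.\<close>

lemma constant_if_increments_flat:
  fixes H V :: "real \<Rightarrow> real"
  assumes flat: "\<And>e. 0 < e \<Longrightarrow> \<exists>d>0. \<forall>x y. 0 \<le> x \<longrightarrow> x \<le> y \<longrightarrow> y \<le> 1 \<longrightarrow> y - x < d \<longrightarrow>
      \<bar>H y - H x\<bar> \<le> e * (V y - V x)"
    and t: "t \<in> I"
  shows "H t = H 0"
proof -
  have small: "\<bar>H t - H 0\<bar> \<le> e * (V t - V 0)" if e: "0 < e" for e
  proof -
    obtain d where d: "0 < d" and dd: "\<And>x y. \<lbrakk>0 \<le> x; x \<le> y; y \<le> 1; y - x < d\<rbrakk> \<Longrightarrow>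
        \<bar>H y - H x\<bar> \<le> e * (V y - V x)"
      using flat[OF e] by blast
    obtain n :: nat where n: "n > 0" "1 / real n < d"
      using d by (metis real_arch_inverse inverse_eq_divide zero_less_iff_neq_zero)
    have step: "\<bar>H (t * real (Suc k) / n) - H (t * real k / n)\<bar>
        \<le> e * (V (t * real (Suc k) / n) - V (t * real k / n))" if k: "k < n" for k
    proof (rule dd)
      show "0 \<le> t * real k / real n" using t by simp
      show "t * real k / real n \<le> t * real (Suc k) / real n"
        using t by (intro divide_right_mono mult_left_mono) auto
      have "t * real (Suc k) \<le> 1 * real n"
        using t k by (intro mult_mono) auto
      then show "t * real (Suc k) / real n \<le> 1" using n by simp
      have "t * real (Suc k) / real n - t * real k / real n = t / n"
        by (simp add: algebra_simps diff_divide_distrib[symmetric])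
      also have "\<dots> \<le> 1 / n" using t by (intro divide_right_mono) auto
      finally show "t * real (Suc k) / real n - t * real k / real n < d" using n by simp
    qed
    have "H t - H 0 = (\<Sum>k<n. H (t * real (Suc k) / n) - H (t * real k / n))"
      using n by (subst sum_lessThan_telescope) auto
    then have "\<bar>H t - H 0\<bar> \<le> (\<Sum>k<n. \<bar>H (t * real (Suc k) / n) - H (t * real k / n)\<bar>)"
      by (simp only: sum_abs)
    also have "\<dots> \<le> (\<Sum>k<n. e * (V (t * real (Suc k) / n) - V (t * real k / n)))"
      by (intro sum_mono step) auto
    also have "\<dots> = e * (V t - V 0)"
      using n by (subst sum_distrib_left[symmetric], subst sum_lessThan_telescope) auto
    finally show ?thesis .
  qed
  show ?thesis
  proof (rule ccontr)
    assume ne: "H t \<noteq> H 0"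
    define w where "w = \<bar>V t - V 0\<bar> + 1"
    define e where "e = \<bar>H t - H 0\<bar> / (2 * w)"
    have "0 < w" by (simp add: w_def add_nonneg_pos)
    then have "0 < e" using ne unfolding e_def by simp
    have "\<bar>H t - H 0\<bar> \<le> e * (V t - V 0)" by (rule small) fact
    also have "\<dots> \<le> e * w"
      using \<open>0 < e\<close> by (intro mult_left_mono) (auto simp: w_def)
    also have "\<dots> = \<bar>H t - H 0\<bar> / 2" unfolding e_def using \<open>0 < w\<close> by (simp add: field_simps)
    finally show False using ne by simp
  qed
qed

text \<open>Product rule. On \<open>{x..y}\<close> the increment of \<open>F * G\<close> minus the integral of the claimed density is
the integral of \<open>f s * (G x - G s) + g s * (F y - F s)\<close>. Uniform continuity of \<open>F\<close> and \<open>G\<close> makes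
both differences small for \<open>y\<close> close to \<open>x\<close>, so the discrepancy is flat relative to the indefinite
integral of \<open>\<bar>f\<bar> + \<bar>g\<bar>\<close> and therefore constant.\<close>

lemma primitive_mult:
  assumes F: "primitive f F" and G: "primitive g G"
  shows "primitive (\<lambda>t. f t * G t + g t * F t) (\<lambda>t. F t * G t)"
proof -
  let ?h = "\<lambda>t. f t * G t + g t * F t"
  let ?v = "\<lambda>t. \<bar>f t\<bar> + \<bar>g t\<bar>"
  have ai: "f absolutely_integrable_on I" "g absolutely_integrable_on I"
    using F G unfolding primitive_def by blast+
  have cont: "continuous_on I F" "continuous_on I G"
    using F G primitive_continuous by auto
  have h: "?h absolutely_integrable_on I"
    using ai cont by (intro set_integral_add absolutely_integrable_mult_continuous)
  have v: "?v absolutely_integrable_on I"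
    using ai by (intro set_integral_add set_integrable_abs)
  define K where "K t = integral {0..t} ?h" for t
  define V where "V t = integral {0..t} ?v" for t
  have K: "primitive ?h K" and V: "primitive ?v V"
    using primitive_integral[OF h, of 0] primitive_integral[OF v, of 0]
    unfolding K_def V_def by simp_all
  have uF: "uniformly_continuous_on I F" and uG: "uniformly_continuous_on I G"
    using cont compact_uniformly_continuous by auto
  have "F t * G t - K t = F 0 * G 0 - K 0" if "t \<in> I" for t
  proof (rule constant_if_increments_flat[OF _ that, of "\<lambda>t. F t * G t - K t" V])
    fix e :: real assume e: "0 < e"
    obtain d1 where d1: "0 < d1" "\<And>x y. \<lbrakk>x \<in> I; y \<in> I; dist y x < d1\<rbrakk> \<Longrightarrow> dist (F y) (F x) < e"
      using uF e unfolding uniformly_continuous_on_def by meson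
    obtain d2 where d2: "0 < d2" "\<And>x y. \<lbrakk>x \<in> I; y \<in> I; dist y x < d2\<rbrakk> \<Longrightarrow> dist (G y) (G x) < e"
      using uG e unfolding uniformly_continuous_on_def by meson
    show "\<exists>d>0. \<forall>x y. 0 \<le> x \<longrightarrow> x \<le> y \<longrightarrow> y \<le> 1 \<longrightarrow> y - x < d \<longrightarrow>
      \<bar>(F y * G y - K y) - (F x * G x - K x)\<bar> \<le> e * (V y - V x)"
    proof (intro exI[of _ "min d1 d2"] conjI allI impI)
      fix x y :: real
      assume xy: "0 \<le> x" "x \<le> y" "y \<le> 1" "y - x < min d1 d2"
      have int: "f integrable_on {x..y}" "g integrable_on {x..y}" "?h integrable_on {x..y}"
          "?v integrable_on {x..y}"
        using primitive_integrable[OF F] primitive_integrable[OF G] primitive_integrable[OF K]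
          primitive_integrable[OF V] xy by auto
      have fG: "(\<lambda>s. f s * G x) integrable_on {x..y}" and gF: "(\<lambda>s. g s * F y) integrable_on {x..y}"
        using int by (auto intro: integrable_on_mult_left)
      have "(F y * G y - K y) - (F x * G x - K x)
          = (F y - F x) * G x + (G y - G x) * F y - (K y - K x)"
        by (simp add: algebra_simps)
      also have "\<dots> = integral {x..y} (\<lambda>s. f s * G x) + integral {x..y} (\<lambda>s. g s * F y)
          - integral {x..y} ?h"
        by (simp add: primitive_increment[OF F] primitive_increment[OF G] primitive_increment[OF K] xy)
      also have "\<dots> = integral {x..y} (\<lambda>s. f s * G x + g s * F y - ?h s)"
        by (simp only: Henstock_Kurzweil_Integration.integral_add[OF fG gF]
            Henstock_Kurzweil_Integration.integral_diff[OF integrable_add[OF fG gF] int(3)])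
      finally have eq: "(F y * G y - K y) - (F x * G x - K x)
          = integral {x..y} (\<lambda>s. f s * G x + g s * F y - ?h s)" .
      have "norm (integral {x..y} (\<lambda>s. f s * G x + g s * F y - ?h s))
          \<le> integral {x..y} (\<lambda>s. e * ?v s)"
      proof (rule integral_norm_bound_integral)
        show "(\<lambda>s. f s * G x + g s * F y - ?h s) integrable_on {x..y}"
          by (rule integrable_diff[OF integrable_add[OF fG gF] int(3)])
        show "(\<lambda>s. e * ?v s) integrable_on {x..y}"
          using int by (intro integrable_on_mult_right)
        fix s assume s: "s \<in> {x..y}"
        have "\<bar>G x - G s\<bar> \<le> e" "\<bar>F y - F s\<bar> \<le> e"
          using d2(2)[of s x] d1(2)[of s y] s xy by (auto simp: dist_real_def)
        then have "\<bar>f s\<bar> * \<bar>G x - G s\<bar> + \<bar>g s\<bar> * \<bar>F y - F s\<bar> \<le> \<bar>f s\<bar> * e + \<bar>g s\<bar> * e"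
          by (intro add_mono mult_left_mono) auto
        moreover have "f s * G x + g s * F y - ?h s = f s * (G x - G s) + g s * (F y - F s)"
          by (simp add: algebra_simps)
        moreover have "\<bar>f s * (G x - G s) + g s * (F y - F s)\<bar>
            \<le> \<bar>f s\<bar> * \<bar>G x - G s\<bar> + \<bar>g s\<bar> * \<bar>F y - F s\<bar>"
          by (metis abs_mult abs_triangle_ineq)
        ultimately show "norm (f s * G x + g s * F y - ?h s) \<le> e * ?v s"
          by (simp add: algebra_simps)
      qed
      also have "\<dots> = e * (V y - V x)"
        by (simp add: primitive_increment[OF V] xy)
      finally show "\<bar>(F y * G y - K y) - (F x * G x - K x)\<bar> \<le> e * (V y - V x)"
        unfolding eq by simp
    qed (use d1 d2 in auto)
  qed
  moreover have "K 0 = 0" by (simp add: K_def)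
  ultimately have "F t * G t = F 0 * G 0 + K t" if "t \<in> I" for t
    using that by fastforce
  then show ?thesis
    unfolding primitive_def K_def[symmetric] using h by blast
qed

section \<open>Absolute continuity, almost everywhere derivatives, and the space \<open>W21\<close>\<close>

text \<open>The indicator functions of disjoint open intervals add up to at most 1.\<close>

lemma sum_integral_disjoint_intervals_le:
  fixes h :: "real \<Rightarrow> real" and x y :: "nat \<Rightarrow> real"
  assumes h: "h integrable_on I" "\<And>s. s \<in> I \<Longrightarrow> 0 \<le> h s"
    and xy: "\<And>i. i < n \<Longrightarrow> x i \<in> I \<and> y i \<in> I \<and> x i \<le> y i"
    and disj: "\<And>i j. \<lbrakk>i < n; j < n; i \<noteq> j\<rbrakk> \<Longrightarrow> {x i<..<y i} \<inter> {x j<..<y j} = {}"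
  shows "(\<Sum>i<n. integral {x i..y i} h) \<le> integral I h"
proof -
  let ?h = "\<lambda>i s. if s \<in> {x i<..<y i} then h s else 0"
  have inter: "{x i<..<y i} \<inter> I = {x i<..<y i}" if "i < n" for i
    using xy[OF that] by auto
  have int: "?h i integrable_on I" if "i < n" for i
  proof -
    have "h integrable_on {x i..y i}"
      by (rule integrable_on_subinterval[OF h(1)]) (use xy[OF that] in auto)
    then show ?thesis
      by (simp only: integrable_restrict_Int inter[OF that] integrable_on_Icc_iff_Ioo)
  qed
  have "(\<Sum>i<n. integral {x i..y i} h) = (\<Sum>i<n. integral I (?h i))"
    by (rule sum.cong[OF refl])
       (simp only: integral_restrict_Int inter integral_open_interval_real lessThan_iff)
  also have "\<dots> = integral I (\<lambda>s. \<Sum>i<n. ?h i s)"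
    by (rule Henstock_Kurzweil_Integration.integral_sum[symmetric]) (use int in auto)
  also have "\<dots> \<le> integral I h"
  proof (rule integral_le)
    show "(\<lambda>s. \<Sum>i<n. ?h i s) integrable_on I"
      by (rule integrable_sum) (use int in auto)
    fix s assume s: "s \<in> I"
    show "(\<Sum>i<n. ?h i s) \<le> h s"
    proof (cases "\<exists>j<n. s \<in> {x j<..<y j}")
      case True
      then obtain j where j: "j < n" "s \<in> {x j<..<y j}" by blast
      have "(\<Sum>i<n. ?h i s) = (\<Sum>i<n. if i = j then h s else 0)"
        by (rule sum.cong[OF refl]) (use j disj in fastforce)
      then show ?thesis using j by simp
    next
      case False
      then have "(\<Sum>i<n. ?h i s) = 0" by (intro sum.neutral) auto
      then show ?thesis using h(2)[OF s] by simp
    qed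
  qed (fact h(1))
  finally show ?thesis .
qed

text \<open>The truncation that yields absolute continuity of the integral: up to an error of small
\<open>L\<^sup>1\<close> norm, \<open>\<bar>f\<bar>\<close> is bounded by a constant \<open>M\<close>. The excess over \<open>n\<close> tends to 0 pointwise and
is dominated by \<open>\<bar>f\<bar>\<close>.\<close>

lemma integrable_tail_small:
  fixes f :: "real \<Rightarrow> real"
  assumes f: "f absolutely_integrable_on I" and e: "0 < e"
  obtains M :: real where "0 \<le> M" "(\<lambda>s. max (\<bar>f s\<bar> - M) 0) integrable_on I"
    "integral I (\<lambda>s. max (\<bar>f s\<bar> - M) 0) < e"
proof -
  let ?h = "\<lambda>(n::nat) s. max (\<bar>f s\<bar> - real n) 0"
  have abs: "(\<lambda>s. \<bar>f s\<bar>) absolutely_integrable_on I"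
    using f by (rule set_integrable_abs)
  have int: "?h n integrable_on I" for n
  proof -
    have "(\<lambda>s. max (\<bar>f s\<bar> - real n) 0) absolutely_integrable_on I"
      by (intro absolutely_integrable_max_1 set_integral_diff abs absolutely_integrable_on_const) auto
    then show ?thesis by (rule set_lebesgue_integral_eq_integral(1))
  qed
  have "(\<lambda>n. integral I (?h n)) \<longlonglongrightarrow> integral I (\<lambda>s. 0::real)"
  proof (rule dominated_convergence(2)[OF int])
    show "(\<lambda>s. \<bar>f s\<bar>) integrable_on I"
      using abs by (rule set_lebesgue_integral_eq_integral(1))
    show "norm (?h n s) \<le> \<bar>f s\<bar>" for n s by auto
    show "(\<lambda>n. ?h n s) \<longlonglongrightarrow> 0" for s
    proof (rule tendsto_eventually)
      obtain N :: nat where "\<bar>f s\<bar> \<le> real N" using real_arch_simple by blast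
      then have "?h n s = 0" if "n \<ge> N" for n using that by (simp add: max_def)
      then show "\<forall>\<^sub>F n in sequentially. ?h n s = 0"
        unfolding eventually_sequentially by blast
    qed
  qed
  then have "\<forall>\<^sub>F n in sequentially. integral I (?h n) < e"
    using e by (simp add: order_tendstoD)
  then obtain n where "integral I (?h n) < e"
    unfolding eventually_sequentially by blast
  then show thesis using that[of "real n"] int[of n] by simp
qed

text \<open>With \<open>\<bar>f\<bar> \<le> M + h\<close>, where \<open>h\<close> is the excess of \<open>\<bar>f\<bar>\<close> over \<open>M\<close>, the absolute increments of \<open>F\<close>
over disjoint intervals sum to at most \<open>M\<close> times their total length plus the integral of \<open>h\<close> over \<open>I\<close>.\<close>

lemma primitive_AC:
  assumes F: "primitive f F"
  shows "F \<in> AC"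
  unfolding AC_def
proof (rule CollectI, intro allI impI)
  fix e :: real assume e: "0 < e"
  have f: "f absolutely_integrable_on I"
    using primitive_absolutely_integrable[OF F, of 0 1] by simp
  obtain M where M: "0 \<le> M" and hi: "(\<lambda>s. max (\<bar>f s\<bar> - M) 0) integrable_on I" (is "?h integrable_on I")
    and small: "integral I (\<lambda>s. max (\<bar>f s\<bar> - M) 0) < e / 2"
    using integrable_tail_small[OF f half_gt_zero[OF e]] by metis
  show "\<exists>d>0. \<forall>(n::nat) (x::nat \<Rightarrow> real) (y::nat \<Rightarrow> real).
     (\<forall>i<n. x i \<in> I \<and> y i \<in> I \<and> x i \<le> y i) \<and>
     (\<forall>i<n. \<forall>j<n. i \<noteq> j \<longrightarrow> {x i<..<y i} \<inter> {x j<..<y j} = {}) \<and>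
     (\<Sum>i<n. y i - x i) < d
     \<longrightarrow> (\<Sum>i<n. \<bar>F (y i) - F (x i)\<bar>) < e"
  proof (intro exI[of _ "e / (2 * (M + 1))"] conjI allI impI)
    show "0 < e / (2 * (M + 1))" using e M by simp
    fix n and x y :: "nat \<Rightarrow> real"
    assume *: "(\<forall>i<n. x i \<in> I \<and> y i \<in> I \<and> x i \<le> y i) \<and>
     (\<forall>i<n. \<forall>j<n. i \<noteq> j \<longrightarrow> {x i<..<y i} \<inter> {x j<..<y j} = {}) \<and>
     (\<Sum>i<n. y i - x i) < e / (2 * (M + 1))"
    have each: "\<bar>F (y i) - F (x i)\<bar> \<le> M * (y i - x i) + integral {x i..y i} ?h" if i: "i < n" for i
    proof -
      have xy: "0 \<le> x i" "x i \<le> y i" "y i \<le> 1" using * i by auto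
      have hi': "?h integrable_on {x i..y i}"
        by (rule integrable_on_subinterval[OF hi]) (use xy in auto)
      have "\<bar>F (y i) - F (x i)\<bar> \<le> integral {x i..y i} (\<lambda>s. \<bar>f s\<bar>)"
        by (rule primitive_increment_bound[OF F xy])
      also have "\<dots> \<le> integral {x i..y i} (\<lambda>s. M + ?h s)"
      proof (rule integral_le)
        show "(\<lambda>s. \<bar>f s\<bar>) integrable_on {x i..y i}"
          using primitive_absolutely_integrable[OF F xy(1,3)]
          by (simp add: absolutely_integrable_on_def)
        show "(\<lambda>s. M + ?h s) integrable_on {x i..y i}"
          by (intro integrable_add hi') auto
      qed auto
      also have "\<dots> = M * (y i - x i) + integral {x i..y i} ?h"
        using Henstock_Kurzweil_Integration.integral_add[OF integrable_const_ivl hi', of M] xy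
        by (simp add: mult.commute)
      finally show ?thesis .
    qed
    have "(\<Sum>i<n. \<bar>F (y i) - F (x i)\<bar>) \<le> (\<Sum>i<n. M * (y i - x i) + integral {x i..y i} ?h)"
      by (rule sum_mono) (use each in auto)
    also have "\<dots> = M * (\<Sum>i<n. y i - x i) + (\<Sum>i<n. integral {x i..y i} ?h)"
      by (simp add: sum.distrib sum_distrib_left)
    also have "\<dots> \<le> M * (e / (2 * (M + 1))) + integral I ?h"
    proof (intro add_mono mult_left_mono)
      show "(\<Sum>i<n. y i - x i) \<le> e / (2 * (M + 1))" using * by linarith
      show "(\<Sum>i<n. integral {x i..y i} ?h) \<le> integral I ?h"
        by (rule sum_integral_disjoint_intervals_le[OF hi]) (use * in \<open>simp_all, blast?\<close>)
    qed (fact M)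
    also have "M * (e / (2 * (M + 1))) \<le> e / 2"
      using e M by (simp add: field_simps)
    finally show "(\<Sum>i<n. \<bar>F (y i) - F (x i)\<bar>) < e" using small by simp
  qed
qed

text \<open>The one-dimensional case of the differentiation theorem for averages over the cubes with lower
corner \<open>x\<close>; in dimension one such a cube is an interval to the right of \<open>x\<close>.\<close>

lemma right_derivative_of_integral_AE:
  fixes f :: "real \<Rightarrow> real"
  assumes f: "\<And>x y. f integrable_on {x..y}"
  obtains N where "negligible N"
    "\<And>x e. \<lbrakk>x \<notin> N; 0 < e\<rbrakk> \<Longrightarrow> \<exists>d>0. \<forall>h. 0 < h \<and> h < d \<longrightarrow> \<bar>integral {x..x + h} f / h - f x\<bar> < e"
proof -
  obtain N where "negligible N"
    "\<And>x e. \<lbrakk>x \<notin> N; 0 < e\<rbrakk> \<Longrightarrow> \<exists>d>0. \<forall>h. 0 < h \<and> h < d \<longrightarrow>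
      norm (integral (cbox x (x + h *\<^sub>R One)) f /\<^sub>R h ^ DIM(real) - f x) < e"
    using integrable_ccontinuous_explicit[of f] f by (metis box_real(2))
  then show thesis using that[of N] by (simp add: divide_inverse mult.commute)
qed

text \<open>Lebesgue's differentiation theorem. Right derivatives come from the averages over intervals to
the right; left derivatives are right derivatives for the reflected function \<open>\<lambda>s. g (- s)\<close>.\<close>

lemma primitive_has_derivative_AE:
  assumes F: "primitive f F"
  shows "AE t in lebesgue. t \<in> I \<longrightarrow> (F has_real_derivative f t) (at t within I)"
proof -
  \<comment> \<open>extension by zero, since the averaging theorem is about functions on the whole line\<close>
  define g where "g x = (if x \<in> I then f x else 0)" for x
  have "g integrable_on UNIV"
    using primitive_integrable[OF F, of 0 1] integrable_restrict_UNIV[of I f]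
    unfolding g_def by simp
  then have g: "g integrable_on {x..y}" for x y
    using integrable_on_subcbox[of g UNIV x y] by simp
  then have "(\<lambda>s. g (- s)) integrable_on {x..y}" for x y
    using Henstock_Kurzweil_Integration.integrable_reflect_real[where f=g and a="- y" and b="- x"] by simp
  then obtain M where M: "negligible M" "\<And>x e. \<lbrakk>x \<notin> M; 0 < e\<rbrakk> \<Longrightarrow>
      \<exists>d>0. \<forall>h. 0 < h \<and> h < d \<longrightarrow> \<bar>integral {x..x + h} (\<lambda>s. g (- s)) / h - g (- x)\<bar> < e"
    using right_derivative_of_integral_AE[of "\<lambda>s. g (- s)"] by blast
  obtain N where N: "negligible N" "\<And>x e. \<lbrakk>x \<notin> N; 0 < e\<rbrakk> \<Longrightarrow>
      \<exists>d>0. \<forall>h. 0 < h \<and> h < d \<longrightarrow> \<bar>integral {x..x + h} g / h - g x\<bar> < e"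
    using right_derivative_of_integral_AE[of g] g by blast
  have inc: "F y - F x = integral {x..y} g" if "0 \<le> x" "x \<le> y" "y \<le> 1" for x y
    unfolding primitive_increment[OF F that]
    by (rule Henstock_Kurzweil_Integration.integral_cong) (use that in \<open>auto simp: g_def\<close>)
  let ?E = "{0, 1} \<union> N \<union> uminus ` M"
  have "negligible (uminus ` M)"
    by (rule negligible_differentiable_image_negligible[OF _ M(1)]) (auto intro: derivative_intros)
  then have E: "negligible ?E"
    using N(1) by (intro negligible_Un) auto
  have deriv: "(F has_real_derivative f t) (at t within I)" if t: "t \<in> I" "t \<notin> ?E" for t
  proof -
    have t01: "0 < t" "t < 1" using t by auto
    have gt: "g t = f t" using t by (simp add: g_def)
    have "- t \<notin> M" using t by force
    have "(F has_real_derivative f t) (at t)"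
      unfolding DERIV_def
    proof (rule LIM_I)
      fix e :: real assume e: "0 < e"
      obtain d1 where d1: "0 < d1" "\<And>h. \<lbrakk>0 < h; h < d1\<rbrakk> \<Longrightarrow> \<bar>integral {t..t + h} g / h - f t\<bar> < e"
        using N(2)[of t e] t(2) e gt by auto
      obtain d2 where d2: "0 < d2" "\<And>h. \<lbrakk>0 < h; h < d2\<rbrakk> \<Longrightarrow>
          \<bar>integral {- t..- t + h} (\<lambda>s. g (- s)) / h - f t\<bar> < e"
        using M(2)[OF \<open>- t \<notin> M\<close> e] gt by auto
      show "\<exists>s>0. \<forall>h. h \<noteq> 0 \<and> norm (h - 0) < s \<longrightarrow> norm ((F (t + h) - F t) / h - f t) < e"
      proof (intro exI[of _ "min (min d1 d2) (min t (1 - t))"] conjI allI impI)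
        fix h :: real
        assume h: "h \<noteq> 0 \<and> norm (h - 0) < min (min d1 d2) (min t (1 - t))"
        show "norm ((F (t + h) - F t) / h - f t) < e"
        proof (cases "0 < h")
          case True
          then have "F (t + h) - F t = integral {t..t + h} g"
            using h t01 by (intro inc) auto
          then show ?thesis using d1(2)[of h] True h by simp
        next
          case False
          then have "h < 0" using h by auto
          have "F t - F (t + h) = integral {t + h..t} g"
            using h t01 \<open>h < 0\<close> by (intro inc) auto
          also have "\<dots> = integral {- t..- t + - h} (\<lambda>s. g (- s))"
            using Henstock_Kurzweil_Integration.integral_reflect_real[of t "t + h" g] by simp
          finally have "integral {- t..- t + - h} (\<lambda>s. g (- s)) / - h = (F (t + h) - F t) / h"
            using \<open>h < 0\<close> by (simp add: field_simps)
          then show ?thesis using d2(2)[of "- h"] \<open>h < 0\<close> h by simp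
        qed
      qed (use d1 d2 t01 in auto)
    qed
    then show ?thesis by (rule has_field_derivative_at_within)
  qed
  have "?E \<in> null_sets lebesgue" using E by (simp only: negligible_iff_null_sets)
  then show ?thesis
    by (rule AE_I') (use deriv in blast)
qed

lemma dI_eqI:
  assumes "(u has_real_derivative d) (at t within I)" "t \<in> I"
  shows "dI u t = d"
  unfolding dI_def using assms
  by (intro vector_derivative_within_closed_interval)
     (auto simp: has_real_derivative_iff_has_vector_derivative)

lemma has_real_derivative_dI:
  assumes "u differentiable (at t within I)" "t \<in> I"
  shows "(u has_real_derivative dI u t) (at t within I)"
proof -
  obtain d where d: "(u has_real_derivative d) (at t within I)"
    using assms(1) unfolding real_differentiable_def by blast
  then show ?thesis using dI_eqI[OF d assms(2)] by simp
qed

lemma has_real_derivative_cong_I: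
  assumes "(u has_real_derivative d) (at t within I)" "t \<in> I" "\<And>s. s \<in> I \<Longrightarrow> v s = u s"
  shows "(v has_real_derivative d) (at t within I)"
  using assms has_vector_derivative_transform[of t I v u d]
  by (simp add: has_real_derivative_iff_has_vector_derivative)

lemma AC_cong:
  assumes "f \<in> AC" "\<And>t. t \<in> I \<Longrightarrow> f t = g t"
  shows "g \<in> AC"
proof -
  have "(\<Sum>i<n. \<bar>g (y i) - g (x i)\<bar>) = (\<Sum>i<n. \<bar>f (y i) - f (x i)\<bar>)"
    if "\<forall>i<n. x i \<in> I \<and> y i \<in> I \<and> x i \<le> y i" for n and x y :: "nat \<Rightarrow> real"
    by (rule sum.cong[OF refl]) (use that assms(2) in auto)
  then show ?thesis
    using assms(1) unfolding AC_def by (simp cong: conj_cong)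
qed

lemma AC_diff:
  assumes "f \<in> AC" "g \<in> AC"
  shows "(\<lambda>t. f t - g t) \<in> AC"
  unfolding AC_def
proof (rule CollectI, intro allI impI)
  fix e :: real assume e: "0 < e"
  define P where "P n x y \<longleftrightarrow> (\<forall>i<n. x i \<in> I \<and> y i \<in> I \<and> x i \<le> y i) \<and>
     (\<forall>i<n. \<forall>j<n. i \<noteq> j \<longrightarrow> {x i<..<y i} \<inter> {x j<..<y j} = {})" for n and x y :: "nat \<Rightarrow> real"
  have ex: "\<exists>d>0. \<forall>n x y. P n x y \<and> (\<Sum>i<n. y i - x i) < d \<longrightarrow> (\<Sum>i<n. \<bar>k (y i) - k (x i)\<bar>) < e / 2"
    if "k \<in> AC" for k
    using that[unfolded AC_def, THEN CollectD, rule_format, of "e / 2"] e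
    unfolding P_def conj_assoc by simp
  obtain d1 where d1: "0 < d1" "\<And>n x y. \<lbrakk>P n x y; (\<Sum>i<n. y i - x i) < d1\<rbrakk> \<Longrightarrow> (\<Sum>i<n. \<bar>f (y i) - f (x i)\<bar>) < e / 2"
    using ex[OF assms(1)] by blast
  obtain d2 where d2: "0 < d2" "\<And>n x y. \<lbrakk>P n x y; (\<Sum>i<n. y i - x i) < d2\<rbrakk> \<Longrightarrow> (\<Sum>i<n. \<bar>g (y i) - g (x i)\<bar>) < e / 2"
    using ex[OF assms(2)] by blast
  have "(\<Sum>i<n. \<bar>(f (y i) - g (y i)) - (f (x i) - g (x i))\<bar>) < e"
    if "P n x y" "(\<Sum>i<n. y i - x i) < min d1 d2" for n x y
  proof -
    have "(\<Sum>i<n. \<bar>(f (y i) - g (y i)) - (f (x i) - g (x i))\<bar>)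
        \<le> (\<Sum>i<n. \<bar>f (y i) - f (x i)\<bar> + \<bar>g (y i) - g (x i)\<bar>)"
      by (rule sum_mono) auto
    also have "\<dots> < e"
      using d1(2)[OF that(1)] d2(2)[OF that(1)] that(2) by (simp add: sum.distrib)
    finally show ?thesis .
  qed
  then have "\<exists>d>0. \<forall>n x y. P n x y \<and> (\<Sum>i<n. y i - x i) < d \<longrightarrow>
      (\<Sum>i<n. \<bar>(f (y i) - g (y i)) - (f (x i) - g (x i))\<bar>) < e"
    using d1(1) d2(1) by (intro exI[of _ "min d1 d2"]) simp
  then show "\<exists>d>0. \<forall>(n::nat) (x::nat \<Rightarrow> real) (y::nat \<Rightarrow> real).
     (\<forall>i<n. x i \<in> I \<and> y i \<in> I \<and> x i \<le> y i) \<and>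
     (\<forall>i<n. \<forall>j<n. i \<noteq> j \<longrightarrow> {x i<..<y i} \<inter> {x j<..<y j} = {}) \<and>
     (\<Sum>i<n. y i - x i) < d
     \<longrightarrow> (\<Sum>i<n. \<bar>(f (y i) - g (y i)) - (f (x i) - g (x i))\<bar>) < e"
    unfolding P_def conj_assoc .
qed

lemma W21_diff:
  assumes "u \<in> W21" "v \<in> W21"
  shows "(\<lambda>t. u t - v t) \<in> W21" and "\<And>t. t \<in> I \<Longrightarrow> dI (\<lambda>t. u t - v t) t = dI u t - dI v t"
proof -
  have d: "((\<lambda>t. u t - v t) has_real_derivative dI u t - dI v t) (at t within I)" if "t \<in> I" for t
    using assms that unfolding W21_def by (intro DERIV_diff has_real_derivative_dI) auto
  then show eq: "dI (\<lambda>t. u t - v t) t = dI u t - dI v t" if "t \<in> I" for t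
    using that by (intro dI_eqI)
  have "(\<lambda>t. dI u t - dI v t) \<in> AC"
    using assms unfolding W21_def by (intro AC_diff) auto
  then have "dI (\<lambda>t. u t - v t) \<in> AC"
    by (rule AC_cong) (simp add: eq)
  moreover have "(\<lambda>t. u t - v t) differentiable (at t within I)" if "t \<in> I" for t
    using d[OF that] unfolding real_differentiable_def by blast
  ultimately show "(\<lambda>t. u t - v t) \<in> W21"
    unfolding W21_def by blast
qed

lemma solves_diff:
  assumes W: "u \<in> W21" "v \<in> W21" and s: "solves a lam u \<sigma>" "solves a lam v \<tau>"
  shows "solves a lam (\<lambda>t. u t - v t) (\<lambda>t. \<sigma> t - \<tau> t)"
  using s unfolding solves_def
proof eventually_elim
  case (elim t)
  show ?case
  proof
    assume t: "t \<in> I"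
    have "((\<lambda>t. dI u t - dI v t) has_real_derivative dI (dI u) t - dI (dI v) t) (at t within I)"
      by (intro DERIV_diff has_real_derivative_dI t) (use elim t in blast)+
    then have d: "(dI (\<lambda>t. u t - v t) has_real_derivative dI (dI u) t - dI (dI v) t) (at t within I)"
      by (rule has_real_derivative_cong_I[OF _ t]) (rule W21_diff(2)[OF W])
    have "L a lam (\<lambda>t. u t - v t) t = L a lam u t - L a lam v t"
      unfolding L_def dI_eqI[OF d t] by (simp add: algebra_simps)
    moreover have "L a lam u t = \<sigma> t" "L a lam v t = \<tau> t"
      using elim t by blast+
    moreover have "dI (\<lambda>t. u t - v t) differentiable (at t within I)"
      using d unfolding real_differentiable_def by blast
    ultimately show "dI (\<lambda>t. u t - v t) differentiable (at t within I) \<and>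
        L a lam (\<lambda>t. u t - v t) t = \<sigma> t - \<tau> t"
      by simp
  qed
qed

lemma primitive_has_derivative_continuous:
  assumes F: "primitive f F" and f: "continuous_on I f" and t: "t \<in> I"
  shows "(F has_real_derivative f t) (at t within I)"
proof -
  have "((\<lambda>t. F 0 + integral {0..t} f) has_real_derivative 0 + f t) (at t within I)"
    by (rule DERIV_add[OF DERIV_const integral_has_real_derivative[OF f t]])
  then have "(F has_real_derivative 0 + f t) (at t within I)"
    by (rule has_real_derivative_cong_I[OF _ t]) (rule primitive_eq[OF F])
  then show ?thesis by simp
qed

text \<open>The bridge from integral identities to the space \<open>W21\<close> and to equations that hold almost
everywhere. A density \<open>r\<close> of \<open>p\<close>, and \<open>p\<close> itself as density of \<open>u\<close>, amount to \<open>u' = p\<close>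
everywhere (as \<open>p\<close> is continuous) and \<open>u'' = r\<close> almost everywhere.\<close>

lemma twice_primitive:
  assumes u: "primitive p u" and p: "primitive r p"
  shows "u \<in> W21" and "\<And>t. t \<in> I \<Longrightarrow> dI u t = p t"
    and "(\<And>t. t \<in> I \<Longrightarrow> r t + (a t + lam) * u t = \<sigma> t) \<Longrightarrow> solves a lam u \<sigma>"
proof -
  have d: "(u has_real_derivative p t) (at t within I)" if "t \<in> I" for t
    by (rule primitive_has_derivative_continuous[OF u primitive_continuous[OF p] that])
  then show eq: "dI u t = p t" if "t \<in> I" for t
    using that by (intro dI_eqI)
  have "dI u \<in> AC" by (rule AC_cong[OF primitive_AC[OF p]]) (simp add: eq)
  moreover have "u differentiable (at t within I)" if "t \<in> I" for t
    using d[OF that] unfolding real_differentiable_def by blast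
  ultimately show "u \<in> W21" unfolding W21_def by blast
  assume \<sigma>: "\<And>t. t \<in> I \<Longrightarrow> r t + (a t + lam) * u t = \<sigma> t"
  show "solves a lam u \<sigma>"
    unfolding solves_def using primitive_has_derivative_AE[OF p]
  proof eventually_elim
    case (elim t)
    show ?case
    proof
      assume t: "t \<in> I"
      then have "(p has_real_derivative r t) (at t within I)" using elim by blast
      then have d2: "(dI u has_real_derivative r t) (at t within I)"
        by (rule has_real_derivative_cong_I[OF _ t]) (rule eq)
      have "L a lam u t = \<sigma> t"
        unfolding L_def dI_eqI[OF d2 t] by (rule \<sigma>[OF t])
      then show "dI u differentiable (at t within I) \<and> L a lam u t = \<sigma> t"
        using d2 unfolding real_differentiable_def by blast
    qed
  qed
qed

section \<open>Solutions of the homogeneous equation\<close>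

text \<open>The equation \<open>u'' + q u = 0\<close> as a first-order system in integral form; \<open>p\<close> is \<open>u'\<close>.\<close>

definition hom_solution :: "(real \<Rightarrow> real) \<Rightarrow> (real \<Rightarrow> real) \<Rightarrow> (real \<Rightarrow> real) \<Rightarrow> bool" where
  "hom_solution q u p \<longleftrightarrow> primitive p u \<and> primitive (\<lambda>s. - q s * u s) p"

text \<open>Extends a continuous function on \<open>I\<close> by its boundary values, so that the Banach space of bounded
continuous functions on the line can serve in place of the continuous functions on \<open>I\<close>.\<close>

lemma clamped_bcontfun:
  fixes h :: "real \<Rightarrow> real"
  assumes "continuous_on I h"
  shows "(\<lambda>t. h (max 0 (min 1 t))) \<in> bcontfun"
proof -
  have "bounded (h ` I)"
    using compact_continuous_image[OF assms] compact_imp_bounded by blast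
  then obtain b where b: "\<And>x. x \<in> I \<Longrightarrow> norm (h x) \<le> b"
    unfolding bounded_iff by blast
  show ?thesis
  proof (rule bcontfun_normI)
    show "continuous_on UNIV (\<lambda>t. h (max 0 (min 1 t)))"
      by (rule continuous_on_compose2[OF assms]) (auto intro!: continuous_intros)
    show "norm (h (max 0 (min 1 t))) \<le> b" for t by (rule b) auto
  qed
qed

text \<open>Integration gains the factor \<open>1 / K\<close> in the norm weighted by \<open>exp (- K * t)\<close>. This gain is what
makes the Volterra operator below a contraction.\<close>

lemma weighted_primitive_bound:
  fixes z :: "real \<Rightarrow> real"
  assumes K: "0 < K" and z: "continuous_on I z" "\<And>r. r \<in> I \<Longrightarrow> \<bar>z r\<bar> \<le> D" and t: "t \<in> I"
  shows "\<bar>integral {0..t} (\<lambda>r. exp (K * r) * z r)\<bar> \<le> D * exp (K * t) / K"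
proof -
  have ct: "continuous_on {0..t} z"
    by (rule continuous_on_subset[OF z(1)]) (use t in auto)
  have ftc: "((\<lambda>r. D * exp (K * r)) has_integral D * exp (K * t) / K - D * exp (K * 0) / K) {0..t}"
  proof (rule fundamental_theorem_of_calculus)
    show "0 \<le> t" using t by simp
    fix x assume "x \<in> {0..t}"
    have "((\<lambda>r. D * exp (K * r) / K) has_real_derivative D * exp (K * x)) (at x within {0..t})"
      using K by (auto intro!: derivative_eq_intros)
    then show "((\<lambda>r. D * exp (K * r) / K) has_vector_derivative D * exp (K * x)) (at x within {0..t})"
      by (simp only: has_real_derivative_iff_has_vector_derivative)
  qed
  have "norm (integral {0..t} (\<lambda>r. exp (K * r) * z r)) \<le> integral {0..t} (\<lambda>r. D * exp (K * r))"
  proof (rule integral_norm_bound_integral)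
    show "(\<lambda>r. exp (K * r) * z r) integrable_on {0..t}"
      by (intro integrable_continuous_real continuous_intros ct)
    show "(\<lambda>r. D * exp (K * r)) integrable_on {0..t}"
      by (intro integrable_continuous_real continuous_intros)
    show "norm (exp (K * r) * z r) \<le> D * exp (K * r)" if "r \<in> {0..t}" for r
      using z(2)[of r] that t by (simp add: abs_mult mult.commute)
  qed
  also have "\<dots> = D * exp (K * t) / K - D / K"
    using integral_unique[OF ftc] by simp
  also have "\<dots> \<le> D * exp (K * t) / K"
    using z(2)[of 0] K by simp
  finally show ?thesis by simp
qed

text \<open>Initial value problem with integrable coefficient. The derivative \<open>p\<close> is a fixed point of
\<open>p t = c1 - integral {0..t} (\<lambda>s. q s * (c0 + integral {0..s} p))\<close>. The inner integral gains a factor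
\<open>1 / K\<close> in the norm weighted by \<open>exp (- K * t)\<close>, and the outer one costs at most the \<open>L\<^sup>1\<close> norm
\<open>Q\<close> of \<open>q\<close>. Hence the map is a contraction of the whole interval at once as soon as \<open>Q / K < 1\<close>.
The unknown of the iteration is the rescaled function \<open>z t = exp (- K * t) * p t\<close>, whose
weighted norm is the plain supremum norm.\<close>

lemma hom_solution_exists:
  assumes q: "q absolutely_integrable_on I"
  obtains u p where "hom_solution q u p" "u 0 = c0" "p 0 = c1"
proof -
  define Q where "Q = integral I (\<lambda>s. \<bar>q s\<bar>)"
  have absq: "(\<lambda>s. \<bar>q s\<bar>) absolutely_integrable_on I" using q by (rule set_integrable_abs)
  then have intq: "(\<lambda>s. \<bar>q s\<bar>) integrable_on {0..t}" if "t \<in> I" for t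
    using that by (intro integrable_on_subinterval_I) auto
  have Q: "0 \<le> Q" unfolding Q_def by (intro integral_nonneg intq) auto
  \<comment> \<open>any \<open>K > 0\<close> with \<open>Q / K \<le> 1 / 2\<close> would do; the summand 1 covers \<open>Q = 0\<close>\<close>
  define K where "K = 2 * Q + 1"
  have K: "0 < K" "Q / K \<le> 1 / 2" using Q by (auto simp: K_def field_simps)
  define U where "U z t = c0 + integral {0..t} (\<lambda>r. exp (K * r) * z r)" for z and t :: real
  define P where "P z t = c1 + integral {0..t} (\<lambda>s. - q s * U z s)" for z and t :: real
  have pU: "primitive (\<lambda>r. exp (K * r) * z r) (U z)" if "continuous_on I z" for z
    unfolding U_def
    by (intro primitive_integral absolutely_integrable_continuous_real continuous_intros that)
  have mq: "(\<lambda>s. - q s) absolutely_integrable_on I"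
    using q unfolding set_integrable_def by simp
  have pP: "primitive (\<lambda>s. - q s * U z s) (P z)" if "continuous_on I z" for z
    unfolding P_def
    by (intro primitive_integral absolutely_integrable_mult_continuous mq
        primitive_continuous[OF pU] that)
  define h where "h z t = exp (- K * t) * P z t" for z and t :: real
  have ch: "continuous_on I (h z)" if "continuous_on I z" for z
    unfolding h_def by (intro continuous_intros primitive_continuous[OF pP] that)
  define T :: "(real \<Rightarrow>\<^sub>C real) \<Rightarrow> (real \<Rightarrow>\<^sub>C real)"
    where "T z = Bcontfun (\<lambda>t. h (apply_bcontfun z) (max 0 (min 1 t)))" for z
  have T: "apply_bcontfun (T z) t = h (apply_bcontfun z) (max 0 (min 1 t))" for z t
    unfolding T_def by (subst Bcontfun_inverse) (auto intro!: clamped_bcontfun ch)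
  have contr: "dist (T z) (T y) \<le> 1 / 2 * dist z y" for z y :: "real \<Rightarrow>\<^sub>C real"
  proof (rule dist_bound)
    fix x :: real
    define t where "t = max 0 (min 1 x)"
    define D where "D = dist z y"
    have t: "t \<in> I" "0 \<le> t" "t \<le> 1" by (auto simp: t_def)
    have D: "\<bar>apply_bcontfun z r - apply_bcontfun y r\<bar> \<le> D" for r
      using dist_bounded[of z r y] by (simp add: D_def dist_real_def)
    have U: "\<bar>U z s - U y s\<bar> \<le> D * exp (K * s) / K" if s: "s \<in> I" for s
    proof -
      have "U z s - U y s = integral {0..s} (\<lambda>r. exp (K * r) * z r - exp (K * r) * y r)"
        unfolding U_def
        by (subst Henstock_Kurzweil_Integration.integral_diff)
           (auto intro!: integrable_continuous_real continuous_intros)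
      also have "\<dots> = integral {0..s} (\<lambda>r. exp (K * r) * (z r - y r))"
        by (simp add: algebra_simps)
      finally show ?thesis
        using weighted_primitive_bound[OF K(1) _ _ s, of "\<lambda>r. z r - y r" D] D
        by (auto intro!: continuous_intros)
    qed
    have iz: "(\<lambda>s. - q s * U v s) integrable_on {0..t}" if "continuous_on I v" for v
      using primitive_integrable[OF pP[OF that]] t by simp
    have "P z t - P y t = integral {0..t} (\<lambda>s. - q s * U z s - - q s * U y s)"
      unfolding P_def
      using Henstock_Kurzweil_Integration.integral_diff[OF iz[of z] iz[of y]] by simp
    also have "norm \<dots> \<le> integral {0..t} (\<lambda>s. \<bar>q s\<bar> * (D * exp (K * t) / K))"
    proof (rule integral_norm_bound_integral)
      show "(\<lambda>s. - q s * U z s - - q s * U y s) integrable_on {0..t}"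
        by (intro integrable_diff iz) auto
      show "(\<lambda>s. \<bar>q s\<bar> * (D * exp (K * t) / K)) integrable_on {0..t}"
        by (intro integrable_on_mult_left intq t)
      fix s assume s: "s \<in> {0..t}"
      have "\<bar>U z s - U y s\<bar> \<le> D * exp (K * s) / K"
        using s t by (intro U) auto
      also have "\<dots> \<le> D * exp (K * t) / K"
        using s K D[of 0] by (intro divide_right_mono mult_left_mono) auto
      finally have "\<bar>q s\<bar> * \<bar>U z s - U y s\<bar> \<le> \<bar>q s\<bar> * (D * exp (K * t) / K)"
        by (intro mult_left_mono) auto
      moreover have "- q s * U z s - - q s * U y s = - q s * (U z s - U y s)"
        by (simp add: algebra_simps)
      ultimately show "norm (- q s * U z s - - q s * U y s) \<le> \<bar>q s\<bar> * (D * exp (K * t) / K)"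
        by (simp add: abs_mult)
    qed
    also have "\<dots> = integral {0..t} (\<lambda>s. \<bar>q s\<bar>) * (D * exp (K * t) / K)"
      by (rule Henstock_Kurzweil_Integration.integral_mult_left)
    also have "\<dots> \<le> Q * (D * exp (K * t) / K)"
    proof (rule mult_right_mono)
      show "integral {0..t} (\<lambda>s. \<bar>q s\<bar>) \<le> Q"
        unfolding Q_def by (rule integral_subset_le) (use t intq in auto)
      show "0 \<le> D * exp (K * t) / K" using K D[of 0] by auto
    qed
    finally have PP: "\<bar>P z t - P y t\<bar> \<le> Q / K * D * exp (K * t)" by simp
    have "\<bar>h z t - h y t\<bar> = exp (- K * t) * \<bar>P z t - P y t\<bar>"
      unfolding h_def by (simp add: right_diff_distrib[symmetric] abs_mult)
    also have "\<dots> \<le> exp (- K * t) * (Q / K * D * exp (K * t))"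
      by (intro mult_left_mono PP) auto
    also have "\<dots> = Q / K * D" by (simp add: exp_minus field_simps)
    also have "\<dots> \<le> 1 / 2 * D" using K D[of 0] by (intro mult_right_mono) auto
    finally show "dist (apply_bcontfun (T z) x) (apply_bcontfun (T y) x) \<le> 1 / 2 * dist z y"
      by (simp add: T t_def[symmetric] D_def dist_real_def)
  qed
  obtain z where z: "T z = z"
    using banach_fix_type[of "1 / 2" T] contr by auto
  have "apply_bcontfun z t = exp (- K * t) * P z t" if "t \<in> I" for t
    using T[of z t] that unfolding z h_def by simp
  then have zP: "exp (K * t) * apply_bcontfun z t = P z t" if "t \<in> I" for t
    using that exp_minus_inverse[of "K * t"] by (simp add: mult.assoc[symmetric])
  have cz: "continuous_on I (apply_bcontfun z)" by simp
  show thesis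
  proof (rule that)
    show "hom_solution q (U z) (P z)"
      unfolding hom_solution_def
      using primitive_cong[OF pU[OF cz] zP] pP[OF cz] by blast
    show "U z 0 = c0" "P z 0 = c1" by (simp_all add: U_def P_def)
  qed
qed

lemma hom_solution_combination:
  assumes "hom_solution q u p" "hom_solution q v r"
  shows "hom_solution q (\<lambda>t. c * u t + d * v t) (\<lambda>t. c * p t + d * r t)"
  unfolding hom_solution_def
proof
  have pr: "primitive p u" "primitive (\<lambda>s. - q s * u s) p" "primitive r v" "primitive (\<lambda>s. - q s * v s) r"
    using assms unfolding hom_solution_def by blast+
  show "primitive (\<lambda>t. c * p t + d * r t) (\<lambda>t. c * u t + d * v t)"
    by (intro primitive_add primitive_cmult pr)
  have "primitive (\<lambda>s. c * (- q s * u s) + d * (- q s * v s)) (\<lambda>t. c * p t + d * r t)"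
    by (intro primitive_add primitive_cmult pr)
  then show "primitive (\<lambda>s. - q s * (c * u s + d * v s)) (\<lambda>t. c * p t + d * r t)"
    by (rule primitive_cong) (simp_all add: algebra_simps)
qed

text \<open>By the product rule the density of the Wronskian is
\<open>p r - q v u + q u v - r p = 0\<close>.\<close>

lemma wronskian_constant:
  assumes "hom_solution q u p" "hom_solution q v r" and t: "t \<in> I"
  shows "u t * r t - p t * v t = u 0 * r 0 - p 0 * v 0"
proof -
  have pr: "primitive p u" "primitive (\<lambda>s. - q s * u s) p" "primitive r v" "primitive (\<lambda>s. - q s * v s) r"
    using assms unfolding hom_solution_def by blast+
  have "primitive (\<lambda>t. (p t * r t + (- q t * v t) * u t) + -1 * ((- q t * u t) * v t + r t * p t))
      (\<lambda>t. u t * r t + -1 * (p t * v t))"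
    by (intro primitive_add primitive_cmult primitive_mult pr)
  then have "primitive (\<lambda>t. 0) (\<lambda>t. u t * r t - p t * v t)"
    by (rule primitive_cong) (simp_all add: algebra_simps)
  from primitive_eq[OF this t] show ?thesis by simp
qed

section \<open>Green's functions built from two homogeneous solutions\<close>

lemma hom_solution_W21:
  assumes "hom_solution (\<lambda>t. a t + lam) u p"
  shows "u \<in> W21" and "\<And>t. t \<in> I \<Longrightarrow> dI u t = p t" and "solves a lam u (\<lambda>_. 0)"
proof -
  have pr: "primitive p u" "primitive (\<lambda>s. - (a s + lam) * u s) p"
    using assms unfolding hom_solution_def by blast+
  show "u \<in> W21" "\<And>t. t \<in> I \<Longrightarrow> dI u t = p t"
    using twice_primitive(1,2)[OF pr] by blast+
  show "solves a lam u (\<lambda>_. 0)"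
    by (rule twice_primitive(3)[OF pr]) (simp add: algebra_simps)
qed

lemma hom_solution_continuous:
  assumes "hom_solution q u p"
  shows "continuous_on I u" "continuous_on I p"
  using assms primitive_continuous unfolding hom_solution_def by blast+

text \<open>The classical kernel of variation of constants: \<open>u\<close> satisfies the boundary condition on the left,
\<open>v\<close> the one on the right, and \<open>w\<close> is their Wronskian. Writing the two cases \<open>t \<le> s\<close> and
\<open>s \<le> t\<close> with \<open>min\<close> and \<open>max\<close> makes joint continuity a matter of composition.\<close>

definition green_kernel :: "(real \<Rightarrow> real) \<Rightarrow> (real \<Rightarrow> real) \<Rightarrow> real \<Rightarrow> real \<Rightarrow> real \<Rightarrow> real" where
  "green_kernel u v w t s = u (min t s) * v (max t s) / w"

lemma green_kernel_continuous:
  assumes "continuous_on I u" "continuous_on I v"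
  shows "continuous_on (I \<times> I) (\<lambda>(t, s). green_kernel u v w t s)"
proof -
  have "continuous_on (I \<times> I) (\<lambda>x. u (min (fst x) (snd x)))"
    by (rule continuous_on_compose2[OF assms(1)]) (auto intro!: continuous_intros)
  moreover have "continuous_on (I \<times> I) (\<lambda>x. v (max (fst x) (snd x)))"
    by (rule continuous_on_compose2[OF assms(2)]) (auto intro!: continuous_intros)
  ultimately have "continuous_on (I \<times> I) (\<lambda>x. u (min (fst x) (snd x)) * v (max (fst x) (snd x)) * inverse w)"
    by (intro continuous_on_mult continuous_on_const)
  then show ?thesis
    by (simp add: green_kernel_def case_prod_unfold divide_inverse)
qed

lemma continuous_section:
  assumes "continuous_on (I \<times> I) (\<lambda>(t, s). G t s)" "t \<in> I"
  shows "continuous_on I (G t)"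
proof -
  have "continuous_on I (\<lambda>s. (\<lambda>(t, s). G t s) (t, s))"
    by (rule continuous_on_compose2[OF assms(1)]) (use assms(2) in \<open>auto intro!: continuous_intros\<close>)
  then show ?thesis by simp
qed

lemma kernel_times_absolutely_integrable:
  fixes G :: "real \<Rightarrow> real \<Rightarrow> real"
  assumes "continuous_on (I \<times> I) (\<lambda>(t, s). G t s)" "t \<in> I" "\<sigma> absolutely_integrable_on I"
  shows "(\<lambda>s. G t s * \<sigma> s) absolutely_integrable_on I"
  using absolutely_integrable_mult_continuous[OF assms(3) continuous_section[OF assms(1,2)]]
  by (simp add: mult.commute)

text \<open>The integral split at \<open>s = t\<close>; the part over \<open>{t..1}\<close> is rewritten with lower limit 0, which is
the form required by \<open>primitive\<close>.\<close>

lemma green_kernel_integral: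
  assumes u: "continuous_on I u" and v: "continuous_on I v" and t: "t \<in> I"
    and \<sigma>: "\<sigma> absolutely_integrable_on I"
  shows "(LINT s:I|lebesgue. green_kernel u v w t s * \<sigma> s) =
    (v t * integral {0..t} (\<lambda>s. \<sigma> s * u s)
      + u t * (integral I (\<lambda>s. \<sigma> s * v s) - integral {0..t} (\<lambda>s. \<sigma> s * v s))) / w"
proof -
  let ?g = "\<lambda>s. green_kernel u v w t s * \<sigma> s"
  have g: "?g absolutely_integrable_on I"
    by (rule kernel_times_absolutely_integrable[OF green_kernel_continuous[OF u v] t \<sigma>])
  have \<sigma>v: "(\<lambda>s. \<sigma> s * v s) absolutely_integrable_on I"
    by (rule absolutely_integrable_mult_continuous[OF \<sigma> v])
  have "(LINT s:I|lebesgue. ?g s) = integral I ?g"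
    by (rule set_lebesgue_integral_eq_integral(2)[OF g])
  also have "\<dots> = integral {0..t} ?g + integral {t..1} ?g"
    by (rule Henstock_Kurzweil_Integration.integral_combine[symmetric])
       (use t set_lebesgue_integral_eq_integral(1)[OF g] in auto)
  also have "integral {0..t} ?g = integral {0..t} (\<lambda>s. v t / w * (\<sigma> s * u s))"
    by (rule Henstock_Kurzweil_Integration.integral_cong) (simp add: green_kernel_def)
  also have "\<dots> = v t / w * integral {0..t} (\<lambda>s. \<sigma> s * u s)"
    by (rule Henstock_Kurzweil_Integration.integral_mult_right)
  also have "integral {t..1} ?g = integral {t..1} (\<lambda>s. u t / w * (\<sigma> s * v s))"
    by (rule Henstock_Kurzweil_Integration.integral_cong) (simp add: green_kernel_def)
  also have "\<dots> = u t / w * integral {t..1} (\<lambda>s. \<sigma> s * v s)"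
    by (rule Henstock_Kurzweil_Integration.integral_mult_right)
  also have "integral {t..1} (\<lambda>s. \<sigma> s * v s)
      = integral I (\<lambda>s. \<sigma> s * v s) - integral {0..t} (\<lambda>s. \<sigma> s * v s)"
    using Henstock_Kurzweil_Integration.integral_combine[of 0 t 1 "\<lambda>s. \<sigma> s * v s"]
      t set_lebesgue_integral_eq_integral(1)[OF \<sigma>v] by simp
  finally show ?thesis by (simp add: add_divide_distrib)
qed

text \<open>Variation of constants. With \<open>A' = \<sigma> u\<close> and \<open>B' = - \<sigma> v\<close> the function \<open>y = (v A + u B) / w\<close> has the
derivative \<open>(r A + p B) / w\<close>, because the terms with \<open>\<sigma>\<close> cancel. Differentiating once more leaves
\<open>- (a + lam) y\<close> plus \<open>\<sigma>\<close> times Wronskian over \<open>w\<close>, and the Wronskian is the constant \<open>w\<close>. Since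
\<open>A 0 = 0\<close> and \<open>B 1 = 0\<close>, \<open>y\<close> inherits homogeneous boundary conditions from \<open>u\<close> at 0 and from
\<open>v\<close> at 1.\<close>

lemma green_kernel_solves:
  assumes u: "hom_solution (\<lambda>t. a t + lam) u p" and v: "hom_solution (\<lambda>t. a t + lam) v r"
    and w: "w = u 0 * r 0 - p 0 * v 0" "w \<noteq> 0"
    and \<sigma>: "\<sigma> absolutely_integrable_on I"
  defines "y \<equiv> \<lambda>t. LINT s:I|lebesgue. green_kernel u v w t s * \<sigma> s"
  shows "y \<in> W21" and "solves a lam y \<sigma>"
    and "\<exists>c. y 0 = c * u 0 \<and> dI y 0 = c * p 0" and "\<exists>d. y 1 = d * v 1 \<and> dI y 1 = d * r 1"
proof -
  note cu = hom_solution_continuous[OF u] and cv = hom_solution_continuous[OF v]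
  have pr: "primitive p u" "primitive (\<lambda>s. - (a s + lam) * u s) p"
      "primitive r v" "primitive (\<lambda>s. - (a s + lam) * v s) r"
    using u v unfolding hom_solution_def by blast+
  define A where "A t = integral {0..t} (\<lambda>s. \<sigma> s * u s)" for t
  define B where "B t = integral I (\<lambda>s. \<sigma> s * v s) + -1 * integral {0..t} (\<lambda>s. \<sigma> s * v s)" for t
  have \<sigma>u: "(\<lambda>s. \<sigma> s * u s) absolutely_integrable_on I"
    and \<sigma>v: "(\<lambda>s. \<sigma> s * v s) absolutely_integrable_on I"
    by (intro absolutely_integrable_mult_continuous \<sigma> cu cv)+
  have A: "primitive (\<lambda>s. \<sigma> s * u s) A"
    using primitive_integral[OF \<sigma>u, of 0] unfolding A_def by simp
  have "primitive (\<lambda>s. -1 * (\<sigma> s * v s)) (\<lambda>t. -1 * (- integral I (\<lambda>s. \<sigma> s * v s)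
      + integral {0..t} (\<lambda>s. \<sigma> s * v s)))"
    by (intro primitive_cmult primitive_integral \<sigma>v)
  then have B: "primitive (\<lambda>s. - (\<sigma> s * v s)) B"
    by (rule primitive_cong) (simp_all add: B_def)
  define m where "m t = (1 / w) * (r t * A t + p t * B t)" for t
  have y: "y t = (1 / w) * (v t * A t + u t * B t)" if "t \<in> I" for t
    unfolding y_def A_def B_def green_kernel_integral[OF cu(1) cv(1) that \<sigma>] by simp
  have "primitive (\<lambda>t. (1 / w) * ((r t * A t + (\<sigma> t * u t) * v t) + (p t * B t + - (\<sigma> t * v t) * u t)))
      (\<lambda>t. (1 / w) * (v t * A t + u t * B t))"
    by (intro primitive_cmult primitive_add primitive_mult pr A B)
  then have my: "primitive m y"
    by (rule primitive_cong) (simp_all add: m_def y algebra_simps)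
  have "primitive (\<lambda>t. (1 / w) * (((- (a t + lam) * v t) * A t + (\<sigma> t * u t) * r t)
        + ((- (a t + lam) * u t) * B t + - (\<sigma> t * v t) * p t))) m"
    unfolding m_def by (intro primitive_cmult primitive_add primitive_mult pr A B)
  moreover have "(1 / w) * (((- (a t + lam) * v t) * A t + (\<sigma> t * u t) * r t)
        + ((- (a t + lam) * u t) * B t + - (\<sigma> t * v t) * p t)) = - (a t + lam) * y t + \<sigma> t"
    if t: "t \<in> I" for t
  proof -
    have "((- (a t + lam) * v t) * A t + (\<sigma> t * u t) * r t)
        + ((- (a t + lam) * u t) * B t + - (\<sigma> t * v t) * p t)
        = - (a t + lam) * (v t * A t + u t * B t) + (u t * r t - p t * v t) * \<sigma> t"
      by (simp add: algebra_simps)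
    also have "u t * r t - p t * v t = w"
      unfolding w(1) by (rule wronskian_constant[OF u v t])
    finally show ?thesis
      unfolding y[OF t] using w(2) by (simp add: field_simps)
  qed
  ultimately have ym: "primitive (\<lambda>t. - (a t + lam) * y t + \<sigma> t) m"
    by (rule primitive_cong[OF _ _ refl])
  show "y \<in> W21" by (rule twice_primitive(1)[OF my ym])
  show "solves a lam y \<sigma>"
    by (rule twice_primitive(3)[OF my ym]) (simp add: algebra_simps)
  have dy: "dI y t = m t" if "t \<in> I" for t
    by (rule twice_primitive(2)[OF my ym that])
  have "y 0 = (B 0 / w) * u 0" "dI y 0 = (B 0 / w) * p 0"
    using y[of 0] dy[of 0] by (simp_all add: m_def A_def)
  then show "\<exists>c. y 0 = c * u 0 \<and> dI y 0 = c * p 0" by blast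
  have "y 1 = (A 1 / w) * v 1" "dI y 1 = (A 1 / w) * r 1"
    using y[of 1] dy[of 1] by (simp_all add: m_def B_def)
  then show "\<exists>d. y 1 = d * v 1 \<and> dI y 1 = d * r 1" by blast
qed

text \<open>The boundary conditions of \<open>X\<close> enter only through \<open>bc\<close>: \<open>X\<close> contains every function whose
boundary data at 0 are proportional to those of \<open>u\<close> and at 1 to those of \<open>v\<close>. Uniqueness of the
solution is nonresonance applied to a difference.\<close>

lemma is_green_kernel:
  assumes u: "hom_solution (\<lambda>t. a t + lam) u p" and v: "hom_solution (\<lambda>t. a t + lam) v r"
    and w: "w = u 0 * r 0 - p 0 * v 0" "w \<noteq> 0"
    and nonres: "nonresonant a lam X"
    and X: "X \<subseteq> W21" "\<And>y z. \<lbrakk>y \<in> X; z \<in> X\<rbrakk> \<Longrightarrow> (\<lambda>t. y t - z t) \<in> X"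
    and bc: "\<And>y c d. \<lbrakk>y \<in> W21; y 0 = c * u 0; dI y 0 = c * p 0; y 1 = d * v 1; dI y 1 = d * r 1\<rbrakk> \<Longrightarrow> y \<in> X"
  shows "is_green a lam X (green_kernel u v w)"
  unfolding is_green_def Let_def
proof (intro conjI allI impI ballI)
  show "continuous_on (I \<times> I) (\<lambda>(t, s). green_kernel u v w t s)"
    by (rule green_kernel_continuous[OF hom_solution_continuous(1)[OF u] hom_solution_continuous(1)[OF v]])
  fix \<sigma> :: "real \<Rightarrow> real" assume \<sigma>: "\<sigma> absolutely_integrable_on I"
  define y where "y t = (LINT s:I|lebesgue. green_kernel u v w t s * \<sigma> s)" for t
  note ys = green_kernel_solves[OF u v w \<sigma>, folded y_def]
  show yX: "(\<lambda>t. LINT s:I|lebesgue. green_kernel u v w t s * \<sigma> s) \<in> X"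
    unfolding y_def[symmetric] using ys(3,4) bc[OF ys(1)] by blast
  show ysol: "solves a lam (\<lambda>t. LINT s:I|lebesgue. green_kernel u v w t s * \<sigma> s) \<sigma>"
    unfolding y_def[symmetric] by (rule ys(2))
  fix z t assume z: "z \<in> X" "solves a lam z \<sigma>" and t: "t \<in> I"
  have "solves a lam (\<lambda>t. z t - y t) (\<lambda>t. \<sigma> t - \<sigma> t)"
    using X(1) z ys by (intro solves_diff) auto
  moreover have "(\<lambda>t. z t - y t) \<in> X"
    using X(2)[OF z(1) yX] by (simp only: y_def)
  ultimately have "z t - y t = 0"
    using nonres t unfolding nonresonant_def by fastforce
  then show "z t = (LINT s:I|lebesgue. green_kernel u v w t s * \<sigma> s)" by (simp add: y_def)
qed

text \<open>Two Green's functions give the same solution for every right-hand side. For fixed \<open>t\<close>, take as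
right-hand side their difference \<open>h = G t - H t\<close>; then the integral of \<open>h\<^sup>2\<close> vanishes, and \<open>h\<close> is
continuous.\<close>

lemma is_green_unique:
  assumes G: "is_green a lam X G" and H: "is_green a lam X H" and t: "t \<in> I" and s: "s \<in> I"
  shows "G t s = H t s"
proof -
  have cG: "continuous_on (I \<times> I) (\<lambda>(t, s). G t s)" and cH: "continuous_on (I \<times> I) (\<lambda>(t, s). H t s)"
    using G H unfolding is_green_def by blast+
  define h where "h s = G t s - H t s" for s
  have ch: "continuous_on I h"
    unfolding h_def by (intro continuous_on_diff continuous_section cG cH t)
  have h: "h absolutely_integrable_on I"
    by (rule absolutely_integrable_continuous_real[OF ch])
  note iG = kernel_times_absolutely_integrable[OF cG t h]
    and iH = kernel_times_absolutely_integrable[OF cH t h]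
  have "(LINT s:I|lebesgue. H t s * h s) = (LINT s:I|lebesgue. G t s * h s)"
    using G H h t unfolding is_green_def Let_def by blast
  then have "integral I (\<lambda>s. G t s * h s) - integral I (\<lambda>s. H t s * h s) = 0"
    by (simp add: set_lebesgue_integral_eq_integral(2)[OF iG] set_lebesgue_integral_eq_integral(2)[OF iH])
  moreover have "integral I (\<lambda>s. h s * h s) = integral I (\<lambda>s. G t s * h s) - integral I (\<lambda>s. H t s * h s)"
    using Henstock_Kurzweil_Integration.integral_diff[OF
        set_lebesgue_integral_eq_integral(1)[OF iG] set_lebesgue_integral_eq_integral(1)[OF iH]]
    by (simp add: h_def left_diff_distrib)
  ultimately have "\<forall>s\<in>I. h s * h s = 0"
    by (subst integral_eq_0_iff[symmetric]) (auto intro!: continuous_intros ch)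
  then show ?thesis using s by (simp add: h_def)
qed

lemma green_eq:
  assumes "is_green a lam X G" "t \<in> I" "s \<in> I"
  shows "green a lam X t s = G t s"
  using is_green_unique[OF someI[of "is_green a lam X", OF assms(1)] assms(1,2,3)]
  by (simp add: green_def)

section \<open>The Neumann and the mixed problem\<close>

text \<open>Near \<open>t = 0\<close>, that is for \<open>t < s\<close>, the kernel is \<open>u t * v s / w\<close>. This gives the derivative for
interior \<open>s\<close>, and the resulting formula is continuous in \<open>s\<close> up to the endpoints.\<close>

lemma dG0_green_kernel:
  assumes u: "(u has_real_derivative d) (at 0 within I)" and v: "continuous_on I v"
    and G: "\<And>t s. \<lbrakk>t \<in> I; s \<in> I\<rbrakk> \<Longrightarrow> G t s = green_kernel u v w t s" and s: "s \<in> I"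
  shows "dG0 G s = d * v s / w"
proof -
  have inner: "dI (\<lambda>t. G t s') 0 = d * v s' / w" if s': "s' \<in> {0<..<1}" for s'
  proof (rule dI_eqI)
    have "((\<lambda>t. u t * (v s' / w)) has_real_derivative d * (v s' / w)) (at 0 within I)"
      by (rule DERIV_cmult_right[OF u])
    then have "((\<lambda>t. u t * (v s' / w)) has_real_derivative d * v s' / w) (at 0 within I)"
      by simp
    then show "((\<lambda>t. G t s') has_real_derivative d * v s' / w) (at 0 within I)"
    proof (rule has_field_derivative_transform_within)
      show "0 < s'" using s' by simp
      show "u t * (v s' / w) = G t s'" if "t \<in> I" "dist t 0 < s'" for t
        using that s' G[of t s'] by (simp add: green_kernel_def)
    qed simp
  qed simp
  show ?thesis
  proof (cases "s \<in> {0<..<1}")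
    case True
    then show ?thesis using inner by (simp add: dG0_def)
  next
    case False
    have "(v \<longlongrightarrow> v s) (at s within {0<..<1})"
      by (rule tendsto_within_subset[where S=I]) (use v s in \<open>auto simp: continuous_on_def\<close>)
    then have "((\<lambda>s'. d * v s' / w) \<longlongrightarrow> d * v s / w) (at s within {0<..<1})"
      unfolding divide_inverse by (intro tendsto_intros)
    then have lim: "((\<lambda>s'. dI (\<lambda>t. G t s') 0) \<longlongrightarrow> d * v s / w) (at s within {0<..<1})"
      by (subst Lim_cong_within[OF refl refl refl inner])
    have "s = 0 \<or> s = 1" using False s by auto
    then have "s islimpt {0<..<1}"
      using islimpt_greaterThanLessThan1[of 0 "1::real"] islimpt_greaterThanLessThan2[of 0 "1::real"]
      by auto
    then have "\<not> trivial_limit (at s within {0<..<1})"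
      by (simp add: trivial_limit_within)
    from tendsto_Lim[OF this lim] show ?thesis
      using False by (auto simp: dG0_def)
  qed
qed

lemma X_N_diff: "\<lbrakk>y \<in> X_N; z \<in> X_N\<rbrakk> \<Longrightarrow> (\<lambda>t. y t - z t) \<in> X_N"
  by (simp add: X_N_def W21_diff)

lemma X_M2_diff: "\<lbrakk>y \<in> X_M2; z \<in> X_M2\<rbrakk> \<Longrightarrow> (\<lambda>t. y t - z t) \<in> X_M2"
  by (simp add: X_M2_def W21_diff)

text \<open>Two candidates for \<open>r5\<close> differ by a homogeneous solution in \<open>X_N\<close>, which vanishes.\<close>

lemma r5_eq:
  assumes nonres: "nonresonant a lam X_N"
    and r: "r \<in> W21" "solves a lam r (\<lambda>_. 0)" "dI r 0 = 1" "dI r 1 = 0" and t: "t \<in> I"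
  shows "r5 a lam t = r t"
proof -
  have r5: "r5 a lam \<in> W21" "solves a lam (r5 a lam) (\<lambda>_. 0)" "dI (r5 a lam) 0 = 1" "dI (r5 a lam) 1 = 0"
    using someI[of "\<lambda>u. u \<in> W21 \<and> solves a lam u (\<lambda>_. 0) \<and> dI u 0 = 1 \<and> dI u 1 = 0" r] r
    unfolding r5_def by blast+
  have "(\<lambda>t. r5 a lam t - r t) \<in> X_N"
    using r r5 by (simp add: X_N_def W21_diff)
  moreover have "solves a lam (\<lambda>t. r5 a lam t - r t) (\<lambda>_. 0)"
    using solves_diff[OF r5(1) r(1) r5(2) r(2)] by simp
  ultimately show ?thesis
    using nonres t unfolding nonresonant_def by fastforce
qed

theorem theorem3p25:
  fixes a :: "real \<Rightarrow> real" and lam :: real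
  assumes "a absolutely_integrable_on I"
    and "nonresonant a lam X_N"
    and "nonresonant a lam X_M2"
  shows "\<forall>t\<in>I. \<forall>s\<in>I.
      G_M2 a lam t s = G_N a lam t s + r5 a lam t * dG0 (G_M2 a lam) s \<and>
      G_N a lam t s + r5 a lam t * dG0 (G_M2 a lam) s
        = G_N a lam t s + G_N a lam t 0 * dG0 (G_M2 a lam) s"
proof -
  let ?q = "\<lambda>t. a t + lam"
  have q: "?q absolutely_integrable_on I"
    by (intro set_integral_add assms(1) absolutely_integrable_on_const) auto
  obtain \<phi> \<phi>' where \<phi>: "hom_solution ?q \<phi> \<phi>'" "\<phi> 0 = 1" "\<phi>' 0 = 0"
    using hom_solution_exists[OF q] by metis
  obtain \<psi> \<psi>' where \<psi>: "hom_solution ?q \<psi> \<psi>'" "\<psi> 0 = 0" "\<psi>' 0 = 1"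
    using hom_solution_exists[OF q] by metis
  \<comment> \<open>nonresonance says that the fundamental solution which satisfies the condition at 0
    violates the one at 1\<close>
  have "\<phi>' 1 \<noteq> 0"
  proof
    assume "\<phi>' 1 = 0"
    then have "\<phi> \<in> X_N" using hom_solution_W21(1,2)[OF \<phi>(1)] \<phi>(3) by (simp add: X_N_def)
    then have "\<phi> 0 = 0"
      using assms(2) hom_solution_W21(3)[OF \<phi>(1)] unfolding nonresonant_def by auto
    then show False using \<phi>(2) by simp
  qed
  have "\<psi>' 1 \<noteq> 0"
  proof
    assume "\<psi>' 1 = 0"
    then have "\<psi> \<in> X_M2" using hom_solution_W21(1,2)[OF \<psi>(1)] \<psi>(2) by (simp add: X_M2_def)
    then have z: "\<psi> t = 0" if "t \<in> I" for t
      using assms(3) hom_solution_W21(3)[OF \<psi>(1)] that unfolding nonresonant_def by auto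
    have "dI \<psi> 0 = 0"
      by (rule dI_eqI, rule has_real_derivative_cong_I[of "\<lambda>_. 0"]) (simp_all add: z)
    then show False using hom_solution_W21(2)[OF \<psi>(1), of 0] \<psi>(3) by simp
  qed
  \<comment> \<open>chosen so that \<open>r = c \<phi> + \<psi>\<close> satisfies \<open>r' 1 = 0\<close>; then \<open>r' 0 = 1\<close>, and \<open>r\<close> is \<open>r5\<close>\<close>
  define c where "c = - \<psi>' 1 / \<phi>' 1"
  have c: "c \<noteq> 0" using \<open>\<phi>' 1 \<noteq> 0\<close> \<open>\<psi>' 1 \<noteq> 0\<close> by (simp add: c_def)
  define r where "r t = c * \<phi> t + 1 * \<psi> t" for t
  define r' where "r' t = c * \<phi>' t + 1 * \<psi>' t" for t
  have r: "hom_solution ?q r r'"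
    unfolding r_def r'_def by (rule hom_solution_combination[OF \<phi>(1) \<psi>(1)])
  have r0: "r 0 = c" "r' 0 = 1" and r1: "r' 1 = 0"
    using \<phi>(2,3) \<psi>(2,3) \<open>\<phi>' 1 \<noteq> 0\<close> by (simp_all add: r_def r'_def c_def)
  have r5: "r5 a lam t = r t" if "t \<in> I" for t
    by (rule r5_eq[OF assms(2) hom_solution_W21(1)[OF r] hom_solution_W21(3)[OF r] _ _ that])
       (simp_all add: hom_solution_W21(2)[OF r] r0 r1)
  have "is_green a lam X_N (green_kernel \<phi> r 1)"
    by (rule is_green_kernel[OF \<phi>(1) r _ _ assms(2) _ X_N_diff])
       (auto simp: \<phi> r0 r1 X_N_def)
  then have GN: "G_N a lam t s = green_kernel \<phi> r 1 t s" if "t \<in> I" "s \<in> I" for t s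
    unfolding G_N_def using that by (rule green_eq)
  have "is_green a lam X_M2 (green_kernel \<psi> r (- c))"
    by (rule is_green_kernel[OF \<psi>(1) r _ _ assms(3) _ X_M2_diff])
       (auto simp: \<psi> r0 r1 c X_M2_def)
  then have GM: "G_M2 a lam t s = green_kernel \<psi> r (- c) t s" if "t \<in> I" "s \<in> I" for t s
    unfolding G_M2_def using that by (rule green_eq)
  have "(\<psi> has_real_derivative dI \<psi> 0) (at 0 within I)"
    using hom_solution_W21(1)[OF \<psi>(1)] unfolding W21_def by (intro has_real_derivative_dI) auto
  moreover have "dI \<psi> 0 = 1" using hom_solution_W21(2)[OF \<psi>(1), of 0] \<psi>(3) by simp
  ultimately have dG: "dG0 (G_M2 a lam) s = 1 * r s / - c" if "s \<in> I" for s
    using dG0_green_kernel[OF _ hom_solution_continuous(1)[OF r] GM that] by simp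
  show ?thesis
  proof (intro ballI conjI)
    fix t s assume t: "t \<in> I" and s: "s \<in> I"
    \<comment> \<open>the product \<open>r t * r s\<close> is symmetric, so that the cases \<open>t \<le> s\<close> and \<open>s \<le> t\<close> coincide\<close>
    have rr: "r t * r s = r (min t s) * r (max t s)"
      by (simp add: min_def max_def mult.commute)
    have "G_M2 a lam t s = \<psi> (min t s) * r (max t s) / - c"
      unfolding GM[OF t s] green_kernel_def ..
    also have "\<dots> = \<phi> (min t s) * r (max t s) + r (min t s) * r (max t s) / - c"
      using c unfolding r_def[of "min t s"] by (simp add: field_simps)
    also have "\<dots> = G_N a lam t s + r5 a lam t * dG0 (G_M2 a lam) s"
      unfolding GN[OF t s] r5[OF t] dG[OF s] rr[symmetric] green_kernel_def by simp
    finally show "G_M2 a lam t s = G_N a lam t s + r5 a lam t * dG0 (G_M2 a lam) s" .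
    have "G_N a lam t 0 = r t"
      using t by (simp add: GN green_kernel_def \<phi>(2))
    then show "G_N a lam t s + r5 a lam t * dG0 (G_M2 a lam) s
        = G_N a lam t s + G_N a lam t 0 * dG0 (G_M2 a lam) s"
      using r5[OF t] by simp
  qed
qed

end
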